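(* There is a constant $C_F$, depending only on the problem data and method parameters, such that the following holds. Let $z\in\mathcal{N}(\tau,\nu)$, where $\tau\in[\sigma\tau_E,\tau_A]$, $0\le\nu\le\nu_2$ and $\hat\tau\in\{\sigma\tau,\tau\}$. Then $$\|z\|_2\le C_z,\qquad\|DF(z)\|_2\le C_{DF},\qquad\|DF(z)^{-1}\|_2\le C_{DFinv},\qquad\|F_{\hat\tau}(z)\|_2\le C_F$$ (in particular $DF(z)$ is invertible).
   Context: $n,m\ge1$; $Q\in\mathbb{R}^{n\times n}$ symmetric positive semidefinite, $c\in\mathbb{R}^n$, $A\in\mathbb{R}^{m\times n}$, $b\in\mathbb{R}^m$, $\mathrm{tol}>0$. $\mathbf 1$ is the all-ones vector; products of vectors of equal length are componentwise. $\|\cdot\|_2$ is the Euclidean/spectral norm, $\|\cdot\|_F$ the Frobenius norm. Method parameters: positive reals satisfying (an upper bound with zero denominator is vacuous) $\theta\le0.3$; $\beta\le\theta$; $1-\beta/\sqrt{2n}\le\sigma<1$; $N=3n+m$; $C_q\ge\|Q\|_2n+\|c\|_2\sqrt n$; $\omega\le\min\{\frac{\mathrm{tol}}{2n},\frac{\mathrm{tol}^2}{16(4C_q+n)},1\}$; $C_\lambda\ge(\|A\|_2\sqrt n+\|b\|_2)/\omega$; $C_{\Delta\mu}\ge(\omega+\|Q\|_2)\sqrt n+\|c\|_2+\|A\|_2C_\lambda$; $\tau_A\ge\max\{\frac14\|Q+\omega I+\frac1\omega A^{\mathsf T}A\|_2,4\|c-\frac1\omega A^{\mathsf T}b\|_2\}$;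 $\tau_E\le\frac{\mathrm{tol}^2\omega}{48n\max\{\|A\|_2,C_q\}}$; $C_\mu\ge\sqrt{2n}(C_{\Delta\mu}+(1+\theta)\tau_A)$; $C_z\ge\sqrt{n+C_\lambda^2+C_\mu^2}+0.1$; $c_{gap}\le\frac{1-\theta}{1+C_z}\cdot\frac{\sigma\tau_E}2$; $C_{DF}\ge\|Q\|_2+2\omega+2\|A\|_F+4+4C_z$; $C_{DFinv}\ge\frac1{c_{gap}}\max\{\frac1\omega,\frac{C_z}{c_{gap}}\}$; $\kappa_{DF}\ge C_{DF}C_{DFinv}$; $C_{\delta F}\ge C_{DF}$; $C_{\delta DF}\ge2$; $C_{\delta\Delta z}\ge2\kappa_{DF}$; $C_\nu\ge\max\{2C_{\delta\Delta z}(C_{\delta F}C_{DFinv}+\frac2\omega C_{\delta DF}C_z),1+C_{DFinv}C_{\delta F}\}$; $\nu_2\le\min\{0.1,\frac{c_{gap}}{C_\nu},\frac\omega{2C_{\delta DF}\kappa_{DF}},\frac{\theta\sigma\tau_E}{2C_\nu C_{\delta F}}\}$. For $z=(x,\lambda,\mu_L,\mu_R)\in\mathbb{R}^n\times\mathbb{R}^m\times\mathbb{R}^n\times\mathbb{R}^n=\mathbb{R}^N$ and $\tau>0$: $$F_\tau(z)=\begin{pmatrix}Qx+\omega x+c-A^{\mathsf T}\lambda-\mu_L+\mu_R\\ Ax-b+\omega\lambda\\ \mu_L\cdot(\mathbf 1+x)-\tau\mathbf 1\\ \mu_R\cdot(\mathbf 1-x)-\tau\mathbf 1\end{pmatrix},$$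 $$DF(z)=\begin{bmatrix}Q+\omega I&-A^{\mathsf T}&-I&I\\ A&\omega I&0&0\\ \mathrm{diag}(\mu_L)&0&\mathrm{diag}(\mathbf 1+x)&0\\ -\mathrm{diag}(\mu_R)&0&0&\mathrm{diag}(\mathbf 1-x)\end{bmatrix}.$$ $\mathcal{N}(\tau)$ is the set of $z\in\mathbb{R}^N$ with $F_\tau(z)=(0_n,0_m,r^{(3)},r^{(4)})$, $\|(r^{(3)},r^{(4)})\|_2\le\theta\tau$, $\|x\|_\infty<1$, $\mu_L>0$, $\mu_R>0$; and $\mathcal{N}(\tau,\nu)=\{\tilde z\in\mathbb{R}^N:\exists z\in\mathcal{N}(\tau),\ \|\tilde z-z\|_2\le\nu\}$. *)

theory Defs
  imports "HOL-Analysis.Analysis"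
begin

text \<open>The space R^N with N = 3n + m is indexed by the sum type below, in the order
  (x, lambda, mu_L, mu_R).\<close>

type_synonym ('n, 'm) zidx = "'n + 'm + 'n + 'n"

definition x_part :: "real ^ ('n::finite, 'm::finite) zidx \<Rightarrow> real ^ 'n" where
  "x_part z = (\<chi> i. z $ Inl i)"

definition lam_part :: "real ^ ('n::finite, 'm::finite) zidx \<Rightarrow> real ^ 'm" where
  "lam_part z = (\<chi> i. z $ Inr (Inl i))"

definition muL_part :: "real ^ ('n::finite, 'm::finite) zidx \<Rightarrow> real ^ 'n" where
  "muL_part z = (\<chi> i. z $ Inr (Inr (Inl i)))"

definition muR_part :: "real ^ ('n::finite, 'm::finite) zidx \<Rightarrow> real ^ 'n" where
  "muR_part z = (\<chi> i. z $ Inr (Inr (Inr i)))"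

text \<open>Concatenation of four vectors. At entry type real this builds an element of R^N; at entry
  type real^N it stacks four block rows of an N x N matrix.\<close>

definition stack4 ::
  "'a ^ 'n \<Rightarrow> 'a ^ 'm \<Rightarrow> 'a ^ 'n \<Rightarrow> 'a ^ 'n \<Rightarrow> 'a ^ ('n::finite, 'm::finite) zidx" where
  "stack4 u v w s = (\<chi> k. case k of
       Inl i \<Rightarrow> u $ i
     | Inr (Inl j) \<Rightarrow> v $ j
     | Inr (Inr (Inl i)) \<Rightarrow> w $ i
     | Inr (Inr (Inr i)) \<Rightarrow> s $ i)"

definition block_row ::
  "real ^ 'n ^ 'k \<Rightarrow> real ^ 'm ^ 'k \<Rightarrow> real ^ 'n ^ 'k \<Rightarrow> real ^ 'n ^ 'k
     \<Rightarrow> real ^ ('n::finite, 'm::finite) zidx ^ 'k::finite" where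
  "block_row B1 B2 B3 B4 = (\<chi> i. stack4 (B1 $ i) (B2 $ i) (B3 $ i) (B4 $ i))"

definition diag_mat :: "real ^ 'n \<Rightarrow> real ^ 'n ^ 'n" where
  "diag_mat v = (\<chi> i j. if i = j then v $ i else 0)"

definition spectral_norm :: "real ^ 'n::finite ^ 'm::finite \<Rightarrow> real" where
  "spectral_norm B = onorm (\<lambda>v. B *v v)"

definition frobenius_norm :: "real ^ 'n::finite ^ 'm::finite \<Rightarrow> real" where
  "frobenius_norm B = sqrt (\<Sum>i\<in>UNIV. \<Sum>j\<in>UNIV. (B $ i $ j)\<^sup>2)"

text \<open>On \<^typ>\<open>real ^ 'n\<close>, the operator \<open>*\<close> is the componentwise product and \<open>1\<close> is the all-ones
  vector; \<open>mat \<omega>\<close> is \<open>\<omega>\<close> times the identity matrix.\<close>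

definition F_map ::
  "real ^ 'n ^ 'n \<Rightarrow> real ^ 'n \<Rightarrow> real ^ 'n ^ 'm \<Rightarrow> real ^ 'm \<Rightarrow> real \<Rightarrow> real
     \<Rightarrow> real ^ ('n::finite, 'm::finite) zidx \<Rightarrow> real ^ ('n, 'm) zidx" where
  "F_map Q c A b \<omega> \<tau> z =
     (let x = x_part z; l = lam_part z; \<mu>L = muL_part z; \<mu>R = muR_part z in
      stack4
        (Q *v x + \<omega> *\<^sub>R x + c - transpose A *v l - \<mu>L + \<mu>R)
        (A *v x - b + \<omega> *\<^sub>R l)
        (\<mu>L * (1 + x) - \<tau> *\<^sub>R 1)
        (\<mu>R * (1 - x) - \<tau> *\<^sub>R 1))"

definition DF_mat ::
  "real ^ 'n ^ 'n \<Rightarrow> real ^ 'n ^ 'm \<Rightarrow> real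
     \<Rightarrow> real ^ ('n::finite, 'm::finite) zidx \<Rightarrow> real ^ ('n, 'm) zidx ^ ('n, 'm) zidx" where
  "DF_mat Q A \<omega> z =
     (let x = x_part z; \<mu>L = muL_part z; \<mu>R = muR_part z in
      stack4
        (block_row (Q + mat \<omega>)       (- transpose A) (- mat 1)          (mat 1))
        (block_row A                 (mat \<omega>)         0                  0)
        (block_row (diag_mat \<mu>L)     0               (diag_mat (1 + x)) 0)
        (block_row (- diag_mat \<mu>R)   0               0                  (diag_mat (1 - x))))"

text \<open>The norm of the pair \<open>(r3, r4)\<close> in the product type is the Euclidean norm of the concatenated
  vector.\<close>

definition nbhd ::
  "real ^ 'n ^ 'n \<Rightarrow> real ^ 'n \<Rightarrow> real ^ 'n ^ 'm \<Rightarrow> real ^ 'm \<Rightarrow> real \<Rightarrow> real \<Rightarrow> real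
     \<Rightarrow> (real ^ ('n::finite, 'm::finite) zidx) set" where
  "nbhd Q c A b \<omega> \<theta> \<tau> =
     {z. (\<exists>r3 r4. F_map Q c A b \<omega> \<tau> z = stack4 0 0 r3 r4 \<and> norm (r3, r4) \<le> \<theta> * \<tau>) \<and>
         infnorm (x_part z) < 1 \<and>
         (\<forall>i. 0 < muL_part z $ i) \<and> (\<forall>i. 0 < muR_part z $ i)}"

definition nbhd_pert ::
  "real ^ 'n ^ 'n \<Rightarrow> real ^ 'n \<Rightarrow> real ^ 'n ^ 'm \<Rightarrow> real ^ 'm \<Rightarrow> real \<Rightarrow> real \<Rightarrow> real \<Rightarrow> real
     \<Rightarrow> (real ^ ('n::finite, 'm::finite) zidx) set" where
  "nbhd_pert Q c A b \<omega> \<theta> \<tau> \<nu> = {z'. \<exists>z \<in> nbhd Q c A b \<omega> \<theta> \<tau>. norm (z' - z) \<le> \<nu>}"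

end

theory Submission
  imports Defs
begin

text \<open>
  A point \<open>z\<^sub>0\<close> of \<open>\<N>(\<tau>)\<close> is bounded block by block (lemma \<open>norm_nbhd_le\<close>): \<open>x\<close> lies in the unit
  box, the second block equation expresses \<open>\<lambda>\<close> through \<open>x\<close>, the first bounds \<open>\<mu>\<^sub>L - \<mu>\<^sub>R\<close>, and
  approximate complementarity bounds at each coordinate one of the two multipliers. As \<open>C_z\<close>
  exceeds the resulting bound by \<open>0.1\<close>, \<open>\<parallel>z\<parallel> \<le> C_z\<close> holds for every \<open>z\<close> at distance at most
  \<open>\<nu>_2 \<le> 0.1\<close>; the bounds on \<open>DF(z)\<close> and \<open>F(z)\<close> follow by the triangle inequality.

  For the inverse of \<open>DF(z)\<close>, complementarity gives
  \<open>\<mu>\<^sub>L (1 + x), \<mu>\<^sub>R (1 - x) \<ge> (1 - \<theta>) \<tau> \<ge> 2 c_gap (1 + C_z)\<close> at \<open>z\<^sub>0\<close>. As one factor is below \<open>2\<close> and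
  the other at most \<open>C_z\<close>, all factors stay at least \<open>c_gap\<close> after a perturbation of size
  \<open>\<nu>_2 \<le> c_gap\<close> (lemma \<open>nbhd_pert_interior\<close>). Dividing the last two block rows of \<open>DF(z)\<close> by the
  multipliers then yields a matrix whose symmetric part is at least
  \<open>min \<omega> (c_gap / C_z)\<close>, which bounds \<open>\<parallel>DF(z) d\<parallel>\<close> from below by a multiple of \<open>\<parallel>d\<parallel>\<close>
  (lemma \<open>DF_mat_lower_bound\<close>); this gives invertibility and the norm of the inverse at once.
\<close>

section \<open>Stacked vectors\<close>

lemma sum_UNIV_sum_type:
  "(\<Sum>k\<in>(UNIV :: ('a::finite + 'b::finite) set). f k) = (\<Sum>i\<in>UNIV. f (Inl i)) + (\<Sum>j\<in>UNIV. f (Inr j))"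
  for f :: "_ \<Rightarrow> 'c::comm_monoid_add"
  by (simp add: UNIV_Plus_UNIV[symmetric] sum.Plus del: UNIV_Plus_UNIV)

lemma stack4_nth [simp]:
  "stack4 u v w s $ Inl i = u $ i"
  "stack4 u v w s $ Inr (Inl j) = v $ j"
  "stack4 u v w s $ Inr (Inr (Inl i)) = w $ i"
  "stack4 u v w s $ Inr (Inr (Inr i)) = s $ i"
  by (simp_all add: stack4_def)

lemma part_nth [simp]:
  "x_part z $ i = z $ Inl i" "lam_part z $ j = z $ Inr (Inl j)"
  "muL_part z $ i = z $ Inr (Inr (Inl i))" "muR_part z $ i = z $ Inr (Inr (Inr i))"
  by (simp_all add: x_part_def lam_part_def muL_part_def muR_part_def)

lemma part_stack4 [simp]:
  "x_part (stack4 u v w s) = u" "lam_part (stack4 u v w s) = v"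
  "muL_part (stack4 u v w s) = w" "muR_part (stack4 u v w s) = s"
  by (simp_all add: vec_eq_iff)

lemma zidx_cases:
  obtains i where "k = Inl i" | j where "k = Inr (Inl j)"
    | i where "k = Inr (Inr (Inl i))" | i where "k = Inr (Inr (Inr i))"
  by (metis sum.exhaust)

lemma stack4_parts: "stack4 (x_part z) (lam_part z) (muL_part z) (muR_part z) = z"
  unfolding vec_eq_iff
proof
  fix k show "stack4 (x_part z) (lam_part z) (muL_part z) (muR_part z) $ k = z $ k"
    by (cases k rule: zidx_cases) simp_all
qed

lemma inner_stack4:
  fixes u w s :: "real ^ 'n::finite" and v :: "real ^ 'm::finite"
  shows "stack4 u v w s \<bullet> stack4 u' v' w' s' = u \<bullet> u' + v \<bullet> v' + w \<bullet> w' + s \<bullet> s'"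
  by (simp add: inner_vec_def sum_UNIV_sum_type)

lemma norm_stack4_power2:
  fixes u w s :: "real ^ 'n::finite" and v :: "real ^ 'm::finite"
  shows "(norm (stack4 u v w s))\<^sup>2 = (norm u)\<^sup>2 + (norm v)\<^sup>2 + (norm w)\<^sup>2 + (norm s)\<^sup>2"
  by (simp add: power2_norm_eq_inner inner_stack4)

lemma norm_parts_power2:
  "(norm z)\<^sup>2 = (norm (x_part z))\<^sup>2 + (norm (lam_part z))\<^sup>2 + (norm (muL_part z))\<^sup>2 + (norm (muR_part z))\<^sup>2"
  by (metis norm_stack4_power2 stack4_parts)

lemma norm_part_le:
  "norm (x_part z) \<le> norm z" "norm (lam_part z) \<le> norm z"
  "norm (muL_part z) \<le> norm z" "norm (muR_part z) \<le> norm z"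
  by (rule power2_le_imp_le; simp add: norm_parts_power2[of z])+

lemma norm_stack4_le:
  fixes u w s :: "real ^ 'n::finite" and v :: "real ^ 'm::finite"
  shows "norm (stack4 u v w s) \<le> norm u + norm v + norm w + norm s"
proof (rule power2_le_imp_le)
  show "(norm (stack4 u v w s))\<^sup>2 \<le> (norm u + norm v + norm w + norm s)\<^sup>2"
    unfolding norm_stack4_power2 by (simp add: power2_eq_square algebra_simps)
qed simp

lemma norm_sum6_le:
  "norm (a + b + c - d - e + f) \<le> norm a + norm b + norm c + norm d + norm e + norm f"
  for a :: "'a::real_normed_vector"
  by (smt (verit) norm_triangle_ineq norm_triangle_ineq4)

lemma norm_power2_cart: "(norm u)\<^sup>2 = (\<Sum>i\<in>UNIV. (u $ i)\<^sup>2)" for u :: "real ^ 'n::finite"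
  by (simp add: norm_vec_def L2_set_def sum_nonneg)

lemma norm_le_of_abs_components_le:
  fixes u v :: "real ^ 'n::finite"
  assumes "\<And>i. \<bar>u $ i\<bar> \<le> K * \<bar>v $ i\<bar>" "0 \<le> K"
  shows "norm u \<le> K * norm v"
proof -
  have "norm u \<le> norm (K *\<^sub>R v)"
    by (rule norm_le_componentwise_cart) (use assms in \<open>simp add: abs_mult\<close>)
  then show ?thesis using assms by simp
qed

lemma norm_times_cart_le:
  fixes u v :: "real ^ 'n::finite"
  shows "norm (u * v) \<le> norm u * norm v"
  by (rule norm_le_of_abs_components_le)
    (auto simp: abs_mult intro: mult_right_mono component_le_norm_cart)

section \<open>Matrix norms\<close>

lemma norm_mult_vec_le: "norm (B *v v) \<le> spectral_norm B * norm v"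
  for B :: "real ^ 'n::finite ^ 'm::finite"
  unfolding spectral_norm_def by (rule onorm[OF matrix_vector_mul_bounded_linear])

lemma spectral_norm_nonneg: "0 \<le> spectral_norm B"
  for B :: "real ^ 'n::finite ^ 'm::finite"
  unfolding spectral_norm_def by (rule onorm_pos_le[OF matrix_vector_mul_bounded_linear])

lemma spectral_norm_bound:
  fixes B :: "real ^ 'n::finite ^ 'm::finite"
  assumes "\<And>v. norm (B *v v) \<le> K * norm v"
  shows "spectral_norm B \<le> K"
  unfolding spectral_norm_def using assms by (rule onorm_le)

lemma norm_transpose_mult_vec_le: "norm (transpose B *v v) \<le> spectral_norm B * norm v"
  for B :: "real ^ 'n::finite ^ 'm::finite"
proof (cases "transpose B *v v = 0")
  case True
  then show ?thesis by (simp add: spectral_norm_nonneg)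
next
  case False
  let ?w = "transpose B *v v"
  have "norm ?w * norm ?w = ?w \<bullet> ?w" by (simp add: norm_eq_sqrt_inner)
  also have "\<dots> = v \<bullet> (B *v ?w)" by (metis dot_lmul_matrix inner_commute transpose_matrix_vector)
  also have "\<dots> \<le> norm v * norm (B *v ?w)" by (rule norm_cauchy_schwarz)
  also have "\<dots> \<le> norm v * (spectral_norm B * norm ?w)"
    by (intro mult_left_mono norm_mult_vec_le) simp
  finally have "norm ?w * norm ?w \<le> (spectral_norm B * norm v) * norm ?w" by (simp add: ac_simps)
  then show ?thesis using False by (simp add: mult_le_cancel_right)
qed

lemma spectral_norm_le_frobenius_norm: "spectral_norm B \<le> frobenius_norm B"
  for B :: "real ^ 'n::finite ^ 'm::finite"
proof (rule spectral_norm_bound)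
  fix v
  have "(norm (B *v v))\<^sup>2 = (\<Sum>i\<in>UNIV. ((B $ i) \<bullet> v)\<^sup>2)"
    unfolding power2_norm_eq_inner by (simp add: inner_vec_def matrix_vector_mult_def power2_eq_square)
  also have "\<dots> \<le> (\<Sum>i\<in>UNIV. (norm (B $ i))\<^sup>2 * (norm v)\<^sup>2)"
    by (intro sum_mono) (metis Cauchy_Schwarz_ineq power2_norm_eq_inner)
  also have "\<dots> = (frobenius_norm B * norm v)\<^sup>2"
    unfolding frobenius_norm_def power_mult_distrib
    by (simp add: sum_nonneg sum_distrib_right[symmetric] norm_vec_def L2_set_def)
  finally show "norm (B *v v) \<le> frobenius_norm B * norm v"
    by (rule power2_le_imp_le) (simp add: frobenius_norm_def sum_nonneg)
qed

lemma invertible_of_norm_lower_bound: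
  fixes B :: "real ^ 'n::finite ^ 'n"
  assumes "\<And>v. norm v \<le> K * norm (B *v v)"
  shows "invertible B" "spectral_norm (matrix_inv B) \<le> K"
proof -
  have "v = 0" if "B *v v = 0" for v
    using assms[of v] that by simp
  then show inv: "invertible B"
    by (simp add: invertible_left_inverse matrix_left_invertible_ker)
  show "spectral_norm (matrix_inv B) \<le> K"
  proof (rule spectral_norm_bound)
    fix v
    have "B ** matrix_inv B = mat 1"
      using inv unfolding invertible_def matrix_inv_def by (metis (mono_tags, lifting) someI_ex)
    then have "B *v (matrix_inv B *v v) = v"
      by (simp add: matrix_vector_mul_assoc)
    with assms[of "matrix_inv B *v v"] show "norm (matrix_inv B *v v) \<le> K * norm v" by simp
  qed
qed

section \<open>The Jacobian\<close>

lemma block_row_mult_vec: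
  "block_row B1 B2 B3 B4 *v d
     = B1 *v x_part d + B2 *v lam_part d + B3 *v muL_part d + B4 *v muR_part d"
  by (simp add: vec_eq_iff block_row_def matrix_vector_mult_def sum_UNIV_sum_type add.assoc)

lemma stack4_mult_vec:
  fixes B1 B3 B4 :: "real ^ ('n::finite, 'm::finite) zidx ^ 'n"
  shows "stack4 B1 B2 B3 B4 *v d = stack4 (B1 *v d) (B2 *v d) (B3 *v d) (B4 *v d)"
  unfolding vec_eq_iff
proof
  fix k show "(stack4 B1 B2 B3 B4 *v d) $ k = stack4 (B1 *v d) (B2 *v d) (B3 *v d) (B4 *v d) $ k"
    by (cases k rule: zidx_cases) (simp_all add: matrix_vector_mult_def)
qed

lemma diag_mat_mult_vec: "diag_mat u *v v = u * v"
  by (simp add: vec_eq_iff diag_mat_def matrix_vector_mult_def if_distrib[of "\<lambda>t. t * _"]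
      cong: if_cong)

lemma mat_mult_vec: "mat a *v v = a *\<^sub>R v" for v :: "real ^ 'n::finite"
  by (simp add: vec_eq_iff mat_def matrix_vector_mult_def if_distrib[of "\<lambda>t. t * _"]
      cong: if_cong)

lemma uminus_mult_vec: "(- B) *v v = - (B *v v)" for B :: "real ^ 'n::finite ^ 'm::finite"
  by (simp add: vec_eq_iff matrix_vector_mult_def sum_negf)

lemma DF_mat_mult_vec:
  "DF_mat Q A \<omega> z *v d = stack4
     (Q *v x_part d + \<omega> *\<^sub>R x_part d - transpose A *v lam_part d - muL_part d + muR_part d)
     (A *v x_part d + \<omega> *\<^sub>R lam_part d)
     (muL_part z * x_part d + (1 + x_part z) * muL_part d)
     (- (muR_part z * x_part d) + (1 - x_part z) * muR_part d)"
  by (simp add: DF_mat_def Let_def stack4_mult_vec block_row_mult_vec diag_mat_mult_vec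
      mat_mult_vec uminus_mult_vec matrix_vector_mult_add_rdistrib)

lemma spectral_norm_DF_mat_le:
  fixes z :: "real ^ ('n::finite, 'm::finite) zidx"
  assumes "0 \<le> \<omega>" "norm z \<le> R"
  shows "spectral_norm (DF_mat Q A \<omega> z)
    \<le> spectral_norm Q + 2 * \<omega> + 2 * frobenius_norm A + 4 + 4 * R"
proof (rule spectral_norm_bound)
  fix d :: "real ^ ('n, 'm) zidx"
  note part = norm_part_le[of d]
  have R: "0 \<le> R" using assms(2) norm_ge_zero[of z] by linarith
  have A: "spectral_norm A \<le> frobenius_norm A" by (rule spectral_norm_le_frobenius_norm)
  have prod: "norm (u * v) \<le> R * norm d" if "norm u \<le> R" "norm v \<le> norm d" for u v :: "real ^ 'n"
    using norm_times_cart_le[of u v] mult_mono[OF that R] by simp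
  have z: "norm (x_part z) \<le> R" "norm (muL_part z) \<le> R" "norm (muR_part z) \<le> R"
    using norm_part_le[of z] assms by linarith+
  have Q1: "norm (Q *v x_part d) \<le> spectral_norm Q * norm d"
    using norm_mult_vec_le[of Q "x_part d"] mult_left_mono[OF part(1) spectral_norm_nonneg[of Q]] by linarith
  have A1: "norm (A *v x_part d) \<le> frobenius_norm A * norm d"
    using norm_mult_vec_le[of A "x_part d"] mult_mono[OF A part(1)] spectral_norm_nonneg[of A] A
    by fastforce
  have A2: "norm (transpose A *v lam_part d) \<le> frobenius_norm A * norm d"
    using norm_transpose_mult_vec_le[of A "lam_part d"] mult_mono[OF A part(2)] spectral_norm_nonneg[of A] A
    by fastforce
  have \<omega>: "\<omega> * norm (x_part d) \<le> \<omega> * norm d" "\<omega> * norm (lam_part d) \<le> \<omega> * norm d"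
    using part assms by (auto intro: mult_left_mono)
  have r1: "norm (Q *v x_part d + \<omega> *\<^sub>R x_part d - transpose A *v lam_part d - muL_part d + muR_part d)
      \<le> (spectral_norm Q + \<omega> + frobenius_norm A + 2) * norm d"
    using norm_sum6_le[of "Q *v x_part d" "\<omega> *\<^sub>R x_part d" 0 "transpose A *v lam_part d" "muL_part d"
        "muR_part d"] Q1 A2 \<omega> part assms(1)
    by (simp add: distrib_right del: transpose_matrix_vector)
  have r2: "norm (A *v x_part d + \<omega> *\<^sub>R lam_part d) \<le> (frobenius_norm A + \<omega>) * norm d"
    by (rule norm_triangle_le) (use A1 \<omega> assms in \<open>simp add: algebra_simps\<close>)
  have r3: "norm (muL_part z * x_part d + (1 + x_part z) * muL_part d) \<le> (1 + 2 * R) * norm d"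
    unfolding distrib_right mult_1
    by (rule norm_triangle_le)
      (use norm_triangle_ineq[of "muL_part d" "x_part z * muL_part d"]
        prod[OF z(2) part(1)] prod[OF z(1) part(3)] part in \<open>simp add: algebra_simps\<close>)
  have r4: "norm (- (muR_part z * x_part d) + (1 - x_part z) * muR_part d) \<le> (1 + 2 * R) * norm d"
    unfolding left_diff_distrib distrib_right mult_1
    by (rule norm_triangle_le)
      (use norm_triangle_ineq4[of "muR_part d" "x_part z * muR_part d"]
        prod[OF z(3) part(1)] prod[OF z(1) part(4)] part in \<open>simp add: algebra_simps\<close>)
  show "norm (DF_mat Q A \<omega> z *v d)
      \<le> (spectral_norm Q + 2 * \<omega> + 2 * frobenius_norm A + 4 + 4 * R) * norm d"
    unfolding DF_mat_mult_vec
    by (rule order_trans[OF norm_stack4_le]) (use r1 r2 r3 r4 in \<open>simp add: algebra_simps\<close>)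
qed

text \<open>Let \<open>g\<close> bound the multipliers and the distances \<open>1 \<plusminus> x\<close> from below and \<open>M\<close> the multipliers
  from above. Dividing the third and fourth block rows of the Jacobian by \<open>\<mu>\<^sub>L\<close> and \<open>\<mu>\<^sub>R\<close> makes the
  off-diagonal blocks skew-symmetric. The symmetric part of the scaled matrix is then
  block-diagonal with blocks \<open>Q + \<omega> I\<close>, \<open>\<omega> I\<close>, \<open>diag ((1 + x) / \<mu>\<^sub>L)\<close> and
  \<open>diag ((1 - x) / \<mu>\<^sub>R)\<close>, hence bounded below by \<open>min \<omega> (g / M)\<close>, and the row scaling
  itself has norm at most \<open>1 / g\<close>.\<close>

lemma DF_mat_lower_bound:
  fixes z d :: "real ^ ('n::finite, 'm::finite) zidx"
  assumes Q_psd: "\<forall>v. 0 \<le> v \<bullet> (Q *v v)" and \<omega>: "0 < \<omega>" and g: "0 < g" "g \<le> 1" and M: "0 < M"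
    and gap: "\<And>i. g \<le> 1 + x_part z $ i" "\<And>i. g \<le> 1 - x_part z $ i"
    and muL: "\<And>i. g \<le> muL_part z $ i" "\<And>i. muL_part z $ i \<le> M"
    and muR: "\<And>i. g \<le> muR_part z $ i" "\<And>i. muR_part z $ i \<le> M"
  shows "norm d \<le> 1 / g * max (1 / \<omega>) (M / g) * norm (DF_mat Q A \<omega> z *v d)"
proof -
  define dx dl dL dR where "dx = x_part d" "dl = lam_part d" "dL = muL_part d" "dR = muR_part d"
  define r1 r2 r3 r4 where
    "r1 = Q *v dx + \<omega> *\<^sub>R dx - transpose A *v dl - dL + dR"
    "r2 = A *v dx + \<omega> *\<^sub>R dl"
    "r3 = muL_part z * dx + (1 + x_part z) * dL"
    "r4 = - (muR_part z * dx) + (1 - x_part z) * dR"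
  define s3 s4 where "s3 = (\<chi> i. r3 $ i / muL_part z $ i)" "s4 = (\<chi> i. r4 $ i / muR_part z $ i)"
  define k where "k = 1 / max (1 / \<omega>) (M / g)"
  have mu_pos: "0 < muL_part z $ i" "0 < muR_part z $ i" for i
    using muL(1)[of i] muR(1)[of i] g by linarith+
  have r: "DF_mat Q A \<omega> z *v d = stack4 r1 r2 r3 r4"
    by (simp add: DF_mat_mult_vec r1_r2_r3_r4_def dx_dl_dL_dR_def)
  have d: "d = stack4 dx dl dL dR"
    by (simp add: dx_dl_dL_dR_def stack4_parts)
  have mx: "0 < max (1 / \<omega>) (M / g)" using \<omega> by (simp add: less_max_iff_disj)
  then have k: "0 < k" by (simp add: k_def)
  have k1: "k \<le> \<omega>"
  proof -
    have "k \<le> 1 / (1 / \<omega>)"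
      unfolding k_def by (rule divide_left_mono) (use mx \<omega> in auto)
    then show ?thesis by simp
  qed
  have k2: "k \<le> g / M"
  proof -
    have "k \<le> 1 / (M / g)"
      unfolding k_def by (rule divide_left_mono) (use mx g M in auto)
    then show ?thesis by simp
  qed

  have ratio: "k \<le> t / m" if "g \<le> t" "0 < m" "m \<le> M" for t m
  proof -
    have "g / M \<le> t / m" using that g by (intro frac_le) auto
    then show ?thesis using k2 by simp
  qed
  have low3: "dx \<bullet> dL + k * (norm dL)\<^sup>2 \<le> dL \<bullet> s3"
  proof -
    have "dx \<bullet> dL + k * (norm dL)\<^sup>2 = (\<Sum>i\<in>UNIV. dL $ i * dx $ i + k * (dL $ i)\<^sup>2)"
      by (simp add: norm_power2_cart inner_vec_def sum.distrib sum_distrib_left mult.commute)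
    also have "\<dots> \<le> (\<Sum>i\<in>UNIV. dL $ i * s3 $ i)"
    proof (rule sum_mono)
      fix i
      have "dL $ i * s3 $ i
          = dL $ i * dx $ i + (1 + x_part z $ i) / muL_part z $ i * (dL $ i)\<^sup>2"
        using mu_pos(1)[of i]
        by (simp add: s3_s4_def r1_r2_r3_r4_def field_simps power2_eq_square)
      then show "dL $ i * dx $ i + k * (dL $ i)\<^sup>2 \<le> dL $ i * s3 $ i"
        using mult_right_mono[OF ratio[OF gap(1)[of i] mu_pos(1)[of i] muL(2)[of i]]
            zero_le_power2[of "dL $ i"]]
        by linarith
    qed
    finally show ?thesis by (simp add: inner_vec_def)
  qed
  have low4: "- (dx \<bullet> dR) + k * (norm dR)\<^sup>2 \<le> dR \<bullet> s4"
  proof -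
    have "- (dx \<bullet> dR) + k * (norm dR)\<^sup>2 = (\<Sum>i\<in>UNIV. - (dR $ i * dx $ i) + k * (dR $ i)\<^sup>2)"
      by (simp add: norm_power2_cart inner_vec_def sum_subtractf sum_distrib_left mult.commute)
    also have "\<dots> \<le> (\<Sum>i\<in>UNIV. dR $ i * s4 $ i)"
    proof (rule sum_mono)
      fix i
      have "dR $ i * s4 $ i
          = - (dR $ i * dx $ i) + (1 - x_part z $ i) / muR_part z $ i * (dR $ i)\<^sup>2"
        using mu_pos(2)[of i]
        by (simp add: s3_s4_def r1_r2_r3_r4_def field_simps power2_eq_square)
      then show "- (dR $ i * dx $ i) + k * (dR $ i)\<^sup>2 \<le> dR $ i * s4 $ i"
        using mult_right_mono[OF ratio[OF gap(2)[of i] mu_pos(2)[of i] muR(2)[of i]]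
            zero_le_power2[of "dR $ i"]]
        by linarith
    qed
    finally show ?thesis by (simp add: inner_vec_def)
  qed
  have skew: "dx \<bullet> (transpose A *v dl) = dl \<bullet> (A *v dx)"
    by (metis dot_lmul_matrix inner_commute transpose_matrix_vector)
  have low1: "dx \<bullet> r1 + dl \<bullet> r2
      = dx \<bullet> (Q *v dx) + \<omega> * (norm dx)\<^sup>2 + \<omega> * (norm dl)\<^sup>2 - dx \<bullet> dL + dx \<bullet> dR"
    unfolding r1_r2_r3_r4_def using skew
    by (simp add: inner_add_right inner_diff_right power2_norm_eq_inner)
  have "k * (norm d)\<^sup>2 = k * (norm dx)\<^sup>2 + k * (norm dl)\<^sup>2 + k * (norm dL)\<^sup>2 + k * (norm dR)\<^sup>2"
    unfolding d norm_stack4_power2 by (simp add: algebra_simps)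
  also have "\<dots> \<le> \<omega> * (norm dx)\<^sup>2 + \<omega> * (norm dl)\<^sup>2 + k * (norm dL)\<^sup>2 + k * (norm dR)\<^sup>2"
    using k1 by (intro add_mono mult_right_mono) auto
  also have "\<dots> \<le> dx \<bullet> r1 + dl \<bullet> r2 + dL \<bullet> s3 + dR \<bullet> s4"
    using low1 low3 low4 Q_psd[rule_format, of dx] by linarith
  also have "\<dots> = d \<bullet> stack4 r1 r2 s3 s4"
    unfolding d by (simp add: inner_stack4)
  also have "\<dots> \<le> norm d * norm (stack4 r1 r2 s3 s4)"
    by (rule norm_cauchy_schwarz)
  finally have "norm d * (k * norm d) \<le> norm d * norm (stack4 r1 r2 s3 s4)"
    by (simp add: power2_eq_square ac_simps)
  then have coercive: "k * norm d \<le> norm (stack4 r1 r2 s3 s4)"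
    by (cases "d = 0") (auto simp: mult_le_cancel_left)

  \<comment> \<open>Because \<open>g \<le> 1\<close>, the factor \<open>1 / g\<close> also covers the two unscaled block rows.\<close>
  have scale: "norm (stack4 r1 r2 s3 s4) \<le> 1 / g * norm (stack4 r1 r2 r3 r4)"
  proof (rule norm_le_of_abs_components_le)
    fix j
    have div: "\<bar>t / m\<bar> \<le> 1 / g * \<bar>t\<bar>" if "g \<le> m" for t m :: real
      using that g by (simp add: frac_le)
    have one: "\<bar>t\<bar> \<le> 1 / g * \<bar>t\<bar>" for t
      using div[OF g(2), of t] by simp
    show "\<bar>stack4 r1 r2 s3 s4 $ j\<bar> \<le> 1 / g * \<bar>stack4 r1 r2 r3 r4 $ j\<bar>"
      by (cases j rule: zidx_cases)
        (use div[OF muL(1)] div[OF muR(1)] one in \<open>simp_all add: s3_s4_def\<close>)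
  qed (use g in simp)
  have "norm d \<le> max (1 / \<omega>) (M / g) * norm (stack4 r1 r2 s3 s4)"
    using coercive mx unfolding k_def by (simp add: field_simps)
  also have "\<dots> \<le> max (1 / \<omega>) (M / g) * (1 / g * norm (stack4 r1 r2 r3 r4))"
    using scale mx by (intro mult_left_mono) auto
  finally show ?thesis by (simp add: r ac_simps)
qed

section \<open>Bounds on the neighbourhood of the central path\<close>

lemma F_map_parts:
  "x_part (F_map Q c A b \<omega> \<tau> z)
     = Q *v x_part z + \<omega> *\<^sub>R x_part z + c - transpose A *v lam_part z - muL_part z + muR_part z"
  "lam_part (F_map Q c A b \<omega> \<tau> z) = A *v x_part z - b + \<omega> *\<^sub>R lam_part z"
  "muL_part (F_map Q c A b \<omega> \<tau> z) = muL_part z * (1 + x_part z) - \<tau> *\<^sub>R 1"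
  "muR_part (F_map Q c A b \<omega> \<tau> z) = muR_part z * (1 - x_part z) - \<tau> *\<^sub>R 1"
  by (simp_all add: F_map_def Let_def)

lemma nbhd_complementarity:
  fixes z :: "real ^ ('n::finite, 'm::finite) zidx"
  assumes "z \<in> nbhd Q c A b \<omega> \<theta> \<tau>"
  shows "\<bar>x_part z $ i\<bar> < 1" "0 < muL_part z $ i" "0 < muR_part z $ i"
    "\<bar>muL_part z $ i * (1 + x_part z $ i) - \<tau>\<bar> \<le> \<theta> * \<tau>"
    "\<bar>muR_part z $ i * (1 - x_part z $ i) - \<tau>\<bar> \<le> \<theta> * \<tau>"
proof -
  from assms obtain r3 r4 where F: "F_map Q c A b \<omega> \<tau> z = stack4 0 0 r3 r4"
    and r: "norm (r3, r4) \<le> \<theta> * \<tau>" and x: "infnorm (x_part z) < 1"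
    and mu: "\<forall>i. 0 < muL_part z $ i" "\<forall>i. 0 < muR_part z $ i"
    unfolding nbhd_def by blast
  show "\<bar>x_part z $ i\<bar> < 1"
    using component_le_infnorm_cart[of "x_part z" i] x by linarith
  show "0 < muL_part z $ i" "0 < muR_part z $ i" using mu by blast+
  have "r3 = muL_part z * (1 + x_part z) - \<tau> *\<^sub>R 1" "r4 = muR_part z * (1 - x_part z) - \<tau> *\<^sub>R 1"
    using F_map_parts(3,4)[of Q c A b \<omega> \<tau> z] unfolding F by simp_all
  moreover have "\<bar>r3 $ i\<bar> \<le> \<theta> * \<tau>" "\<bar>r4 $ i\<bar> \<le> \<theta> * \<tau>"
    using component_le_norm_cart[of r3 i] component_le_norm_cart[of r4 i]
      norm_fst_le[of r3 r4] norm_snd_le[of r4 r3] r by linarith+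
  ultimately show "\<bar>muL_part z $ i * (1 + x_part z $ i) - \<tau>\<bar> \<le> \<theta> * \<tau>"
    "\<bar>muR_part z $ i * (1 - x_part z $ i) - \<tau>\<bar> \<le> \<theta> * \<tau>"
    by simp_all
qed

lemma nbhd_stationarity:
  assumes "z \<in> nbhd Q c A b \<omega> \<theta> \<tau>"
  shows "muL_part z - muR_part z = Q *v x_part z + \<omega> *\<^sub>R x_part z + c - transpose A *v lam_part z"
    "\<omega> *\<^sub>R lam_part z = b - A *v x_part z"
proof -
  from assms obtain r3 r4 where F: "F_map Q c A b \<omega> \<tau> z = stack4 0 0 r3 r4"
    unfolding nbhd_def by blast
  show "muL_part z - muR_part z = Q *v x_part z + \<omega> *\<^sub>R x_part z + c - transpose A *v lam_part z"
    using F_map_parts(1)[of Q c A b \<omega> \<tau> z] unfolding F by (simp add: algebra_simps)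
  show "\<omega> *\<^sub>R lam_part z = b - A *v x_part z"
    using F_map_parts(2)[of Q c A b \<omega> \<tau> z] unfolding F by (simp add: algebra_simps)
qed

text \<open>At each coordinate one of \<open>1 + x\<^sub>i\<close> and \<open>1 - x\<^sub>i\<close> is at least \<open>1\<close>, so complementarity
  bounds the corresponding multiplier by \<open>(1 + \<theta>) \<tau>\<close>; the difference of the two multipliers
  is bounded by stationarity, which controls the other one.\<close>

lemma norm_nbhd_le:
  fixes z :: "real ^ ('n::finite, 'm::finite) zidx" and Q :: "real ^ 'n ^ 'n" and A :: "real ^ 'n ^ 'm"
  assumes z: "z \<in> nbhd Q c A b \<omega> \<theta> \<tau>" and \<omega>: "0 < \<omega>" and \<theta>: "0 \<le> \<theta>" and \<tau>: "\<tau> \<le> T"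
    and Cl: "(spectral_norm A * sqrt (real CARD('n)) + norm b) / \<omega> \<le> Cl"
    and CD: "(\<omega> + spectral_norm Q) * sqrt (real CARD('n)) + norm c + spectral_norm A * Cl \<le> CD"
    and Cm: "sqrt (2 * real CARD('n)) * (CD + (1 + \<theta>) * T) \<le> Cm"
  shows "norm z \<le> sqrt (real CARD('n) + Cl\<^sup>2 + Cm\<^sup>2)"
proof -
  define N where "N = real CARD('n)"
  note compl = nbhd_complementarity[OF z] and stat = nbhd_stationarity[OF z]
  have N: "0 \<le> N" by (simp add: N_def)
  have x: "norm (x_part z) \<le> sqrt N"
  proof -
    have "infnorm (x_part z) \<le> 1" using z by (simp add: nbhd_def)
    then have "sqrt N * infnorm (x_part z) \<le> sqrt N * 1" by (intro mult_left_mono) (auto simp: N)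
    moreover have "norm (x_part z) \<le> sqrt N * infnorm (x_part z)"
      using norm_le_infnorm[of "x_part z"] by (simp add: N_def)
    ultimately show ?thesis by linarith
  qed
  have "\<omega> * norm (lam_part z) = norm (b - A *v x_part z)"
    using stat(2) \<omega> by (metis abs_of_pos norm_scaleR)
  also have "\<dots> \<le> norm b + spectral_norm A * norm (x_part z)"
    using norm_triangle_ineq4[of b "A *v x_part z"] norm_mult_vec_le[of A "x_part z"] by linarith
  also have "\<dots> \<le> norm b + spectral_norm A * sqrt N"
    using mult_left_mono[OF x spectral_norm_nonneg[of A]] by linarith
  finally have "norm (lam_part z) \<le> (spectral_norm A * sqrt N + norm b) / \<omega>"
    using \<omega> by (simp add: field_simps)
  then have lam: "norm (lam_part z) \<le> Cl" using Cl by (simp add: N_def)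
  have "norm (muL_part z - muR_part z)
      \<le> norm (Q *v x_part z) + \<omega> * norm (x_part z) + norm c + norm (transpose A *v lam_part z)"
    unfolding stat(1)
    using norm_sum6_le[of "Q *v x_part z" "\<omega> *\<^sub>R x_part z" c "transpose A *v lam_part z" 0 0] \<omega>
    by (simp del: transpose_matrix_vector)
  also have "\<dots> \<le> spectral_norm Q * sqrt N + \<omega> * sqrt N + norm c + spectral_norm A * Cl"
    using norm_mult_vec_le[of Q "x_part z"] norm_transpose_mult_vec_le[of A "lam_part z"]
      mult_left_mono[OF x spectral_norm_nonneg[of Q]] mult_left_mono[OF x, of \<omega>]
      mult_left_mono[OF lam spectral_norm_nonneg[of A]] \<omega> by linarith
  also have "\<dots> \<le> CD" using CD by (simp add: N_def algebra_simps)
  finally have diff: "norm (muL_part z - muR_part z) \<le> CD" .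
  have comp: "muL_part z $ i \<le> CD + (1 + \<theta>) * T \<and> muR_part z $ i \<le> CD + (1 + \<theta>) * T" for i
  proof -
    have d: "\<bar>muL_part z $ i - muR_part z $ i\<bar> \<le> CD"
      using component_le_norm_cart[of "muL_part z - muR_part z" i] diff by simp
    have t: "(1 + \<theta>) * \<tau> \<le> (1 + \<theta>) * T" using \<tau> \<theta> by (intro mult_left_mono) auto
    have expand: "(1 + \<theta>) * \<tau> = \<tau> + \<theta> * \<tau>" by (simp add: algebra_simps)
    show ?thesis
    proof (cases "0 \<le> x_part z $ i")
      case True
      have "muL_part z $ i * 1 \<le> muL_part z $ i * (1 + x_part z $ i)"
        by (rule mult_left_mono) (use True compl(2)[of i] in linarith)+
      then have "muL_part z $ i \<le> (1 + \<theta>) * \<tau>" using compl(4)[of i] expand by linarith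
      then show ?thesis using d t by linarith
    next
      case False
      have "muR_part z $ i * 1 \<le> muR_part z $ i * (1 - x_part z $ i)"
        by (rule mult_left_mono) (use False compl(3)[of i] in linarith)+
      then have "muR_part z $ i \<le> (1 + \<theta>) * \<tau>" using compl(5)[of i] expand by linarith
      then show ?thesis using d t by linarith
    qed
  qed
  define B where "B = CD + (1 + \<theta>) * T"
  have sq: "(norm u)\<^sup>2 \<le> N * B\<^sup>2" if "\<And>i. 0 < u $ i" "\<And>i. u $ i \<le> B" for u :: "real ^ 'n"
  proof -
    have "(norm u)\<^sup>2 = (\<Sum>i\<in>UNIV. (u $ i)\<^sup>2)"
      by (rule norm_power2_cart)
    also have "\<dots> \<le> (\<Sum>i\<in>(UNIV :: 'n set). B\<^sup>2)"
      by (intro sum_mono power_mono) (use that less_imp_le in blast)+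
    finally show ?thesis by (simp add: N_def)
  qed
  have B: "0 < B" using comp[of undefined] compl(2)[of undefined] by (simp add: B_def)
  have "(norm (muL_part z))\<^sup>2 + (norm (muR_part z))\<^sup>2 \<le> 2 * N * B\<^sup>2"
    using sq[of "muL_part z"] sq[of "muR_part z"] compl(2,3) comp by (simp add: B_def)
  also have "\<dots> = (sqrt (2 * N) * B)\<^sup>2" using N by (simp add: power_mult_distrib)
  also have "\<dots> \<le> Cm\<^sup>2" using Cm B N by (intro power_mono) (auto simp: N_def B_def)
  finally have mu: "(norm (muL_part z))\<^sup>2 + (norm (muR_part z))\<^sup>2 \<le> Cm\<^sup>2" .
  have "(norm (x_part z))\<^sup>2 \<le> N" using power_mono[OF x, of 2] N by simp
  moreover have "(norm (lam_part z))\<^sup>2 \<le> Cl\<^sup>2" using power_mono[OF lam, of 2] by simp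
  ultimately have "(norm z)\<^sup>2 \<le> N + Cl\<^sup>2 + Cm\<^sup>2"
    unfolding norm_parts_power2[of z] using mu by linarith
  then show ?thesis unfolding N_def by (rule real_le_rsqrt)
qed

text \<open>Used with a multiplier \<open>m\<close> and the distance \<open>t\<close> of a coordinate of \<open>x\<close> to \<open>\<plusminus>1\<close>.\<close>

lemma product_factors_ge:
  fixes g M m t :: real
  assumes "2 * g * (1 + M) \<le> m * t" "0 < g" "0 < t" "t < 2" "0 < m" "m \<le> M"
  shows "g * (1 + M) \<le> m" "2 * g \<le> t"
proof -
  have "m * t \<le> m * 2" using assms by (intro mult_left_mono) auto
  then show "g * (1 + M) \<le> m" using assms by linarith
  have "m * t \<le> M * t" using assms by (intro mult_right_mono) auto
  then have "M * (2 * g) + 2 * g \<le> M * t" using assms(1) by (simp add: algebra_simps)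
  then have "M * (2 * g) \<le> M * t" using assms by linarith
  then show "2 * g \<le> t" using assms by (simp add: mult_le_cancel_left)
qed

text \<open>The quantity \<open>2 g (1 + M)\<close> leaves a margin of \<open>g\<close> in every factor, which absorbs a
  perturbation of norm at most \<open>g\<close>. The bound \<open>g \<le> 1\<close> is a by-product of \<open>1 + x\<^sub>i < 2\<close>.\<close>

lemma nbhd_pert_interior:
  fixes z z0 :: "real ^ ('n::finite, 'm::finite) zidx"
  assumes z0: "z0 \<in> nbhd Q c A b \<omega> \<theta> \<tau>" and M: "norm z0 \<le> M" "1 \<le> M"
    and g: "0 < g" "2 * g * (1 + M) \<le> (1 - \<theta>) * \<tau>" and close: "norm (z - z0) \<le> g"
  shows "g \<le> 1" "g \<le> 1 + x_part z $ i" "g \<le> 1 - x_part z $ i"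
    "g \<le> muL_part z $ i" "g \<le> muR_part z $ i"
proof -
  note compl = nbhd_complementarity[OF z0, of i]
  have near: "\<bar>z $ k - z0 $ k\<bar> \<le> g" for k
    using component_le_norm_cart[of "z - z0" k] close by simp
  have le: "\<bar>z0 $ k\<bar> \<le> M" for k
    using component_le_norm_cart[of z0 k] M by linarith
  have "(1 - \<theta>) * \<tau> \<le> muL_part z0 $ i * (1 + x_part z0 $ i)"
    "(1 - \<theta>) * \<tau> \<le> muR_part z0 $ i * (1 - x_part z0 $ i)"
    using compl(4,5) by (auto simp: algebra_simps abs_le_iff)
  then have prods: "2 * g * (1 + M) \<le> muL_part z0 $ i * (1 + x_part z0 $ i)"
    "2 * g * (1 + M) \<le> muR_part z0 $ i * (1 - x_part z0 $ i)"
    using g(2) by linarith+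
  have L: "g * (1 + M) \<le> muL_part z0 $ i" "2 * g \<le> 1 + x_part z0 $ i"
    by (rule product_factors_ge[OF prods(1) g(1)]; use compl le in \<open>auto simp: abs_le_iff\<close>)+
  have R: "g * (1 + M) \<le> muR_part z0 $ i" "2 * g \<le> 1 - x_part z0 $ i"
    by (rule product_factors_ge[OF prods(2) g(1)]; use compl le in \<open>auto simp: abs_le_iff\<close>)+
  show "g \<le> 1 + x_part z $ i" "g \<le> 1 - x_part z $ i"
    using L(2) R(2) near[of "Inl i"] by (auto simp: abs_le_iff)
  have gM: "2 * g \<le> g * (1 + M)" using g(1) M(2) by simp
  show "g \<le> muL_part z $ i" "g \<le> muR_part z $ i"
    using L(1) R(1) gM near[of "Inr (Inr (Inl i))"] near[of "Inr (Inr (Inr i))"]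
    by (auto simp: abs_le_iff)
  show "g \<le> 1" using L(2) compl(1) by linarith
qed

lemma norm_F_map_le:
  fixes z :: "real ^ ('n::finite, 'm::finite) zidx" and Q :: "real ^ 'n ^ 'n" and A :: "real ^ 'n ^ 'm"
  assumes "norm z \<le> R" "0 \<le> \<omega>" "0 \<le> \<tau>" "\<tau> \<le> T"
  shows "norm (F_map Q c A b \<omega> \<tau> z)
    \<le> (spectral_norm Q + 2 * \<omega> + 2 * spectral_norm A + 2) * R + norm c + norm b
       + 2 * (R * (norm (1 :: real ^ 'n) + R) + T * norm (1 :: real ^ 'n))"
proof -
  have R: "0 \<le> R" using assms(1) norm_ge_zero[of z] by linarith
  have z: "norm (x_part z) \<le> R" "norm (lam_part z) \<le> R" "norm (muL_part z) \<le> R" "norm (muR_part z) \<le> R"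
    using norm_part_le[of z] assms by linarith+
  have mult: "norm (Q *v x_part z) \<le> spectral_norm Q * R"
    "norm (A *v x_part z) \<le> spectral_norm A * R"
    "norm (transpose A *v lam_part z) \<le> spectral_norm A * R"
    "\<omega> * norm (x_part z) \<le> \<omega> * R" "\<omega> * norm (lam_part z) \<le> \<omega> * R"
    using order_trans[OF norm_mult_vec_le mult_left_mono[OF z(1) spectral_norm_nonneg]]
      order_trans[OF norm_transpose_mult_vec_le mult_left_mono[OF z(2) spectral_norm_nonneg]]
      z assms by (auto intro: mult_left_mono)
  have r1: "norm (x_part (F_map Q c A b \<omega> \<tau> z))
      \<le> spectral_norm Q * R + \<omega> * R + norm c + spectral_norm A * R + 2 * R"
    unfolding F_map_parts
    by (rule order_trans[OF norm_sum6_le])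
      (use mult z assms in \<open>simp del: transpose_matrix_vector\<close>)
  have r2: "norm (lam_part (F_map Q c A b \<omega> \<tau> z)) \<le> spectral_norm A * R + norm b + \<omega> * R"
    unfolding F_map_parts
    using norm_sum6_le[of "A *v x_part z" "\<omega> *\<^sub>R lam_part z" 0 b 0 0] mult(2,5) assms(2)
    by (simp add: algebra_simps)
  have prod: "norm (u * v - \<tau> *\<^sub>R 1) \<le> R * (norm (1 :: real ^ 'n) + R) + T * norm (1 :: real ^ 'n)"
    if "norm u \<le> R" "norm v \<le> norm (1 :: real ^ 'n) + R" for u v :: "real ^ 'n"
  proof (rule norm_triangle_le_diff)
    have "norm (u * v) \<le> R * (norm (1 :: real ^ 'n) + R)"
      using norm_times_cart_le[of u v] mult_mono[OF that R] by simp
    moreover have "\<tau> * norm (1 :: real ^ 'n) \<le> T * norm (1 :: real ^ 'n)"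
      using assms by (intro mult_right_mono) auto
    moreover have "norm (\<tau> *\<^sub>R (1 :: real ^ 'n)) = \<tau> * norm (1 :: real ^ 'n)"
      using assms by simp
    ultimately show "norm (u * v) + norm (\<tau> *\<^sub>R (1 :: real ^ 'n))
        \<le> R * (norm (1 :: real ^ 'n) + R) + T * norm (1 :: real ^ 'n)"
      by linarith
  qed
  have r3: "norm (muL_part (F_map Q c A b \<omega> \<tau> z))
      \<le> R * (norm (1 :: real ^ 'n) + R) + T * norm (1 :: real ^ 'n)"
    unfolding F_map_parts
    by (rule prod) (use z norm_triangle_ineq[of "1 :: real ^ 'n" "x_part z"] in linarith)+
  have r4: "norm (muR_part (F_map Q c A b \<omega> \<tau> z))
      \<le> R * (norm (1 :: real ^ 'n) + R) + T * norm (1 :: real ^ 'n)"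
    unfolding F_map_parts
    by (rule prod) (use z norm_triangle_ineq4[of "1 :: real ^ 'n" "x_part z"] in linarith)+
  have "norm (F_map Q c A b \<omega> \<tau> z)
      \<le> norm (x_part (F_map Q c A b \<omega> \<tau> z)) + norm (lam_part (F_map Q c A b \<omega> \<tau> z))
        + norm (muL_part (F_map Q c A b \<omega> \<tau> z)) + norm (muR_part (F_map Q c A b \<omega> \<tau> z))"
    by (metis norm_stack4_le stack4_parts)
  then show ?thesis using r1 r2 r3 r4 by (simp add: algebra_simps)
qed

section \<open>The uniform bounds\<close>

theorem theorem4p2:
  fixes Q :: "real ^ 'n::finite ^ 'n" and c :: "real ^ 'n"
    and A :: "real ^ 'n ^ 'm::finite" and b :: "real ^ 'm"
    and tol \<theta> \<beta> \<sigma> C_q \<omega> C_lam C_\<Delta>\<mu> \<tau>_A \<tau>_E C_\<mu> C_z c_gap C_DF C_DFinv \<kappa>_DF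
      C_\<delta>F C_\<delta>DF C_\<delta>\<Delta>z C_\<nu> \<nu>_2 :: real
  assumes Q_sym: "transpose Q = Q"
    and Q_psd: "\<forall>v. 0 \<le> v \<bullet> (Q *v v)"
    and pos: "0 < tol" "0 < \<theta>" "0 < \<beta>" "0 < \<sigma>" "0 < C_q" "0 < \<omega>" "0 < C_lam" "0 < C_\<Delta>\<mu>"
      "0 < \<tau>_A" "0 < \<tau>_E" "0 < C_\<mu>" "0 < C_z" "0 < c_gap" "0 < C_DF" "0 < C_DFinv" "0 < \<kappa>_DF"
      "0 < C_\<delta>F" "0 < C_\<delta>DF" "0 < C_\<delta>\<Delta>z" "0 < C_\<nu>" "0 < \<nu>_2"
    and "\<theta> \<le> 0.3"
    and "\<beta> \<le> \<theta>"
    and "1 - \<beta> / sqrt (2 * real CARD('n)) \<le> \<sigma>" "\<sigma> < 1"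
    and "C_q \<ge> spectral_norm Q * real CARD('n) + norm c * sqrt (real CARD('n))"
    and "\<omega> \<le> Min {tol / (2 * real CARD('n)), tol\<^sup>2 / (16 * (4 * C_q + real CARD('n))), 1}"
    and "C_lam \<ge> (spectral_norm A * sqrt (real CARD('n)) + norm b) / \<omega>"
    and "C_\<Delta>\<mu> \<ge> (\<omega> + spectral_norm Q) * sqrt (real CARD('n)) + norm c + spectral_norm A * C_lam"
    and "\<tau>_A \<ge> max (1/4 * spectral_norm (Q + mat \<omega> + (1/\<omega>) *\<^sub>R (transpose A ** A)))
                  (4 * norm (c - (1/\<omega>) *\<^sub>R (transpose A *v b)))"
    and "\<tau>_E \<le> tol\<^sup>2 * \<omega> / (48 * real CARD('n) * max (spectral_norm A) C_q)"
    and "C_\<mu> \<ge> sqrt (2 * real CARD('n)) * (C_\<Delta>\<mu> + (1 + \<theta>) * \<tau>_A)"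
    and "C_z \<ge> sqrt (real CARD('n) + C_lam\<^sup>2 + C_\<mu>\<^sup>2) + 0.1"
    and "c_gap \<le> (1 - \<theta>) / (1 + C_z) * (\<sigma> * \<tau>_E / 2)"
    and "C_DF \<ge> spectral_norm Q + 2 * \<omega> + 2 * frobenius_norm A + 4 + 4 * C_z"
    and "C_DFinv \<ge> 1 / c_gap * max (1/\<omega>) (C_z / c_gap)"
    and "\<kappa>_DF \<ge> C_DF * C_DFinv"
    and "C_\<delta>F \<ge> C_DF"
    and "C_\<delta>DF \<ge> 2"
    and "C_\<delta>\<Delta>z \<ge> 2 * \<kappa>_DF"
    and "C_\<nu> \<ge> max (2 * C_\<delta>\<Delta>z * (C_\<delta>F * C_DFinv + 2/\<omega> * C_\<delta>DF * C_z)) (1 + C_DFinv * C_\<delta>F)"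
    and "\<nu>_2 \<le> Min {0.1, c_gap / C_\<nu>, \<omega> / (2 * C_\<delta>DF * \<kappa>_DF),
                   \<theta> * \<sigma> * \<tau>_E / (2 * C_\<nu> * C_\<delta>F)}"
  shows "\<exists>C_F::real. \<forall>\<tau> \<nu> \<tau>' z.
           z \<in> nbhd_pert Q c A b \<omega> \<theta> \<tau> \<nu> \<longrightarrow>
           \<tau> \<in> {\<sigma> * \<tau>_E .. \<tau>_A} \<longrightarrow> 0 \<le> \<nu> \<longrightarrow> \<nu> \<le> \<nu>_2 \<longrightarrow> \<tau>' \<in> {\<sigma> * \<tau>, \<tau>} \<longrightarrow>
             norm z \<le> C_z \<and>
             spectral_norm (DF_mat Q A \<omega> z) \<le> C_DF \<and>
             invertible (DF_mat Q A \<omega> z) \<and>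
             spectral_norm (matrix_inv (DF_mat Q A \<omega> z)) \<le> C_DFinv \<and>
             norm (F_map Q c A b \<omega> \<tau>' z) \<le> C_F"
proof -
  define C_F where "C_F = (spectral_norm Q + 2 * \<omega> + 2 * spectral_norm A + 2) * C_z + norm c + norm b
       + 2 * (C_z * (norm (1 :: real ^ 'n) + C_z) + \<tau>_A * norm (1 :: real ^ 'n))"
  let ?S = "sqrt (real CARD('n) + C_lam\<^sup>2 + C_\<mu>\<^sup>2)"
  have Cl: "(spectral_norm A * sqrt (real CARD('n)) + norm b) / \<omega> \<le> C_lam"
    and CD: "(\<omega> + spectral_norm Q) * sqrt (real CARD('n)) + norm c + spectral_norm A * C_lam \<le> C_\<Delta>\<mu>"
    and Cm: "sqrt (2 * real CARD('n)) * (C_\<Delta>\<mu> + (1 + \<theta>) * \<tau>_A) \<le> C_\<mu>"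
    and Cz: "?S + 0.1 \<le> C_z"
    and gap: "c_gap \<le> (1 - \<theta>) / (1 + C_z) * (\<sigma> * \<tau>_E / 2)"
    and CDF: "spectral_norm Q + 2 * \<omega> + 2 * frobenius_norm A + 4 + 4 * C_z \<le> C_DF"
    and CDFinv: "1 / c_gap * max (1/\<omega>) (C_z / c_gap) \<le> C_DFinv"
    using assms by blast+
  have \<theta>: "\<theta> \<le> 0.3" and \<sigma>: "\<sigma> < 1" using assms by blast+
  have Cnu: "1 + C_DFinv * C_\<delta>F \<le> C_\<nu>" using assms by simp
  have nu2: "\<nu>_2 \<le> 0.1" "\<nu>_2 \<le> c_gap / C_\<nu>" using assms by simp_all
  \<comment> \<open>Since \<open>C_\<nu> \<ge> 1\<close>, an admissible perturbation is no larger than \<open>c_gap\<close>.\<close>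
  have "0 < C_DFinv * C_\<delta>F" using pos by simp
  then have "1 \<le> C_\<nu>" using Cnu by linarith
  then have "c_gap / C_\<nu> \<le> c_gap" using pos by (simp add: field_simps)
  then have nu2g: "\<nu>_2 \<le> c_gap" using nu2 by linarith
  have "1 \<le> real CARD('n) + C_lam\<^sup>2 + C_\<mu>\<^sup>2"
    by (smt (verit) zero_le_power2 of_nat_1 of_nat_le_iff Suc_leI zero_less_card_finite One_nat_def)
  then have "1 \<le> ?S" by simp
  then have Cz1: "1 \<le> C_z" using Cz by linarith
  have gap2: "2 * c_gap * (1 + C_z) \<le> (1 - \<theta>) * (\<sigma> * \<tau>_E)"
    using gap Cz1 by (simp add: field_simps)
  show ?thesis
  proof (intro exI[of _ C_F] allI impI)
    fix \<tau> \<nu> \<tau>' and z :: "real ^ ('n, 'm) zidx"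
    assume zp: "z \<in> nbhd_pert Q c A b \<omega> \<theta> \<tau> \<nu>" and \<tau>: "\<tau> \<in> {\<sigma> * \<tau>_E .. \<tau>_A}"
      and \<nu>: "0 \<le> \<nu>" "\<nu> \<le> \<nu>_2" and \<tau>': "\<tau>' \<in> {\<sigma> * \<tau>, \<tau>}"
    from zp obtain z0 where z0: "z0 \<in> nbhd Q c A b \<omega> \<theta> \<tau>" and close: "norm (z - z0) \<le> \<nu>"
      unfolding nbhd_pert_def by blast
    have n0: "norm z0 \<le> ?S"
      by (rule norm_nbhd_le[OF z0 _ _ _ Cl CD Cm]) (use pos \<tau> in auto)
    have nz: "norm z \<le> C_z"
      using norm_triangle_ineq[of "z - z0" z0] n0 close \<nu> nu2 Cz by simp
    have "(1 - \<theta>) * (\<sigma> * \<tau>_E) \<le> (1 - \<theta>) * \<tau>"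
      using \<tau> \<theta> by (intro mult_left_mono) auto
    then have "2 * c_gap * (1 + C_z) \<le> (1 - \<theta>) * \<tau>" using gap2 by linarith
    moreover have "norm z0 \<le> C_z" using n0 Cz by linarith
    moreover have "norm (z - z0) \<le> c_gap" using close \<nu> nu2g by linarith
    ultimately have inter: "c_gap \<le> 1" "c_gap \<le> 1 + x_part z $ i" "c_gap \<le> 1 - x_part z $ i"
      "c_gap \<le> muL_part z $ i" "c_gap \<le> muR_part z $ i" for i
      using nbhd_pert_interior[OF z0 _ Cz1 \<open>0 < c_gap\<close>] by blast+
    have le: "z $ k \<le> C_z" for k
      using component_le_norm_cart[of z k] nz by linarith
    have low: "norm d \<le> C_DFinv * norm (DF_mat Q A \<omega> z *v d)" for d
    proof -
      have "norm d \<le> 1 / c_gap * max (1 / \<omega>) (C_z / c_gap) * norm (DF_mat Q A \<omega> z *v d)"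
        by (rule DF_mat_lower_bound) (use Q_psd pos inter le in auto)
      also have "\<dots> \<le> C_DFinv * norm (DF_mat Q A \<omega> z *v d)"
        using CDFinv by (intro mult_right_mono) auto
      finally show ?thesis .
    qed
    have "0 < \<sigma> * \<tau>_E" using pos by simp
    then have "0 < \<tau>" "\<tau> \<le> \<tau>_A" using \<tau> by auto
    moreover have "0 \<le> \<sigma> * \<tau>" using pos(4) \<open>0 < \<tau>\<close> by simp
    moreover have "\<sigma> * \<tau> \<le> \<tau>_A"
      using mult_right_mono[of \<sigma> 1 \<tau>] \<sigma> \<open>0 < \<tau>\<close> \<open>\<tau> \<le> \<tau>_A\<close> by linarith
    ultimately have "0 \<le> \<tau>'" "\<tau>' \<le> \<tau>_A"
      using \<tau>' by auto
    then have "norm (F_map Q c A b \<omega> \<tau>' z) \<le> C_F"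
      unfolding C_F_def using nz pos by (intro norm_F_map_le) auto
    moreover have "spectral_norm (DF_mat Q A \<omega> z) \<le> C_DF"
      using spectral_norm_DF_mat_le[OF _ nz, of \<omega> Q A] CDF pos by linarith
    ultimately show "norm z \<le> C_z \<and> spectral_norm (DF_mat Q A \<omega> z) \<le> C_DF \<and>
        invertible (DF_mat Q A \<omega> z) \<and> spectral_norm (matrix_inv (DF_mat Q A \<omega> z)) \<le> C_DFinv \<and>
        norm (F_map Q c A b \<omega> \<tau>' z) \<le> C_F"
      using nz invertible_of_norm_lower_bound[OF low] by blast
  qed
qed

end
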